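(* Let $K$ be a field, $\kappa,\lambda\in K$, let $(A,\mu,\alpha,\beta)$ be a BiHom-commutative BiHom-associative algebra, let $\xi:A\to A$ be an algebra map and let $\mathfrak D:A\to A$ be a $\lambda$-$(\xi,\xi)$-derivation, such that any two of the maps $\alpha,\beta,\xi,\mathfrak D$ commute. Define a new multiplication on $A$ by $$a\ast b=\xi(a)\mathfrak D(b)+\kappa\,\xi(a)\xi(b),\qquad a,b\in A.$$ Then $(A,\ast,\alpha\xi,\beta\xi)$ is a BiHom-pre-Lie algebra and a BiHom-Novikov algebra.
   Context: BiHom-associative algebra $(A,\mu,\alpha,\beta)$: a $K$-vector space with linear $\mu:A\otimes A\to A$ (written $ab$), $\alpha,\beta:A\to A$ such that $\alpha\beta=\beta\alpha$, $\alpha(ab)=\alpha(a)\alpha(b)$, $\beta(ab)=\beta(a)\beta(b)$, $\alpha(a)(bc)=(ab)\beta(c)$. BiHom-commutative: $\beta(a)\alpha(b)=\beta(b)\alpha(a)$ for all $a,b$. An algebra map is a linear map $f$ with $f(ab)=f(a)f(b)$ (no unit is assumed). $\lambda$-$(\xi,\xi)$-derivation: a linear $\mathfrak D:A\to A$ with $\mathfrak D(ab)=\xi(a)\mathfrak D(b)+\mathfrak D(a)\xi(b)+\lambda\xi(a)\xi(b)$. (Left) BiHom-pre-Lie algebra $(A,\circ,\alpha,\beta)$: bilinear $\circ$, commuting linear $\alpha,\beta$ multiplicative for $\circ$, with $\alpha\beta(a)\circ(\alpha(b)\circ c)-(\beta(a)\circ\alpha(b))\circ\beta(c)=\alpha\beta(b)\circ(\alpha(a)\circ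 c)-(\beta(b)\circ\alpha(a))\circ\beta(c)$. It is a BiHom-Novikov algebra if moreover $(a\circ\beta(b))\circ\alpha\beta(c)=(a\circ\beta(c))\circ\alpha\beta(b)$ for all $a,b,c$. *)

theory Defs
  imports Main "HOL.Vector_Spaces"
begin

text \<open>A linear map on the tensor square is represented by the corresponding bilinear operation.\<close>

definition bilinear_op ::
  "('k::field \<Rightarrow> 'a::ab_group_add \<Rightarrow> 'a) \<Rightarrow> ('a \<Rightarrow> 'a \<Rightarrow> 'a) \<Rightarrow> bool" where
  "bilinear_op scale mult \<longleftrightarrow>
     (\<forall>a. Vector_Spaces.linear scale scale (\<lambda>b. mult a b)) \<and>
     (\<forall>b. Vector_Spaces.linear scale scale (\<lambda>a. mult a b))"

definition algebra_map ::
  "('k::field \<Rightarrow> 'a::ab_group_add \<Rightarrow> 'a) \<Rightarrow> ('a \<Rightarrow> 'a \<Rightarrow> 'a) \<Rightarrow> ('a \<Rightarrow> 'a) \<Rightarrow> bool" where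
  "algebra_map scale mult f \<longleftrightarrow>
     Vector_Spaces.linear scale scale f \<and> (\<forall>a b. f (mult a b) = mult (f a) (f b))"

locale bihom_structure = vector_space scale
  for scale :: "'k::field \<Rightarrow> 'a::ab_group_add \<Rightarrow> 'a" +
  fixes mult :: "'a \<Rightarrow> 'a \<Rightarrow> 'a"
    and \<alpha> :: "'a \<Rightarrow> 'a"
    and \<beta> :: "'a \<Rightarrow> 'a"
  assumes bilinear: "bilinear_op scale mult"
    and algebra_map_\<alpha>: "algebra_map scale mult \<alpha>"
    and algebra_map_\<beta>: "algebra_map scale mult \<beta>"
    and \<alpha>_\<beta>_commute: "\<alpha> \<circ> \<beta> = \<beta> \<circ> \<alpha>"

locale bihom_associative_algebra = bihom_structure +
  assumes bihom_assoc: "mult (\<alpha> a) (mult b c) = mult (mult a b) (\<beta> c)"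

locale bihom_commutative_associative_algebra = bihom_associative_algebra +
  assumes bihom_comm: "mult (\<beta> a) (\<alpha> b) = mult (\<beta> b) (\<alpha> a)"

locale bihom_pre_lie_algebra = bihom_structure +
  assumes bihom_pre_lie:
    "mult (\<alpha> (\<beta> a)) (mult (\<alpha> b) c) - mult (mult (\<beta> a) (\<alpha> b)) (\<beta> c) =
     mult (\<alpha> (\<beta> b)) (mult (\<alpha> a) c) - mult (mult (\<beta> b) (\<alpha> a)) (\<beta> c)"

locale bihom_novikov_algebra = bihom_pre_lie_algebra +
  assumes bihom_novikov:
    "mult (mult a (\<beta> b)) (\<alpha> (\<beta> c)) = mult (mult a (\<beta> c)) (\<alpha> (\<beta> b))"

definition weighted_derivation ::
  "('k::field \<Rightarrow> 'a::ab_group_add \<Rightarrow> 'a) \<Rightarrow> ('a \<Rightarrow> 'a \<Rightarrow> 'a) \<Rightarrow> 'k \<Rightarrow> ('a \<Rightarrow> 'a) \<Rightarrow> ('a \<Rightarrow> 'a) \<Rightarrow> bool"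
where
  "weighted_derivation scale mult lam \<xi> D \<longleftrightarrow>
     Vector_Spaces.linear scale scale D \<and>
     (\<forall>a b. D (mult a b) =
        mult (\<xi> a) (D b) + mult (D a) (\<xi> b) + scale lam (mult (\<xi> a) (\<xi> b)))"

end

theory Submission
  imports Defs
begin

text \<open>Put \<open>E = D + \<kappa> \<xi>\<close>. Then \<open>a \<ast> b = \<xi>(a) E(b)\<close>, and \<open>E\<close> is again a weighted derivation, of weight
  \<open>\<lambda> - \<kappa>\<close>, so one may assume \<open>\<kappa> = 0\<close>. Expanding \<open>\<alpha>\<beta>\<xi>\<^sup>2(a) \<ast> (\<alpha>\<xi>(b) \<ast> c)\<close> by the derivation rule and
  re-bracketing by BiHom-associativity gives three terms: two are symmetric in \<open>a, b\<close> by
  BiHom-commutativity, and the third is exactly \<open>(\<beta>\<xi>(a) \<ast> \<alpha>\<xi>(b)) \<ast> \<beta>\<xi>(c)\<close>. The Novikov identity is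
  BiHom-commutativity after re-bracketing.\<close>

lemma bilinear_opD:
  assumes "bilinear_op scale mult"
  shows "mult a (b + c) = mult a b + mult a c"
    and "mult (a + b) c = mult a c + mult b c"
    and "mult a (scale k b) = scale k (mult a b)"
    and "mult (scale k a) b = scale k (mult a b)"
  using assms by (auto simp: bilinear_op_def Vector_Spaces.linear_iff)

lemma algebra_mapD:
  assumes "algebra_map scale mult f"
  shows "f (a + b) = f a + f b" and "f (scale k a) = scale k (f a)"
    and "f (mult a b) = mult (f a) (f b)"
  using assms by (auto simp: algebra_map_def Vector_Spaces.linear_iff)

lemma weighted_derivationD:
  assumes "weighted_derivation scale mult lam \<xi> D"
  shows "D (a + b) = D a + D b" and "D (scale k a) = scale k (D a)"
    and "D (mult a b) =
      mult (\<xi> a) (D b) + mult (D a) (\<xi> b) + scale lam (mult (\<xi> a) (\<xi> b))"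
  using assms by (auto simp: weighted_derivation_def Vector_Spaces.linear_iff)

lemma algebra_map_comp:
  assumes "algebra_map scale mult f" and "algebra_map scale mult g"
  shows "algebra_map scale mult (f \<circ> g)"
  using assms by (auto simp: algebra_map_def Vector_Spaces.linear_iff)

text \<open>Applying \<xi> to a product contributes one \<kappa> \<xi>(a) \<xi>(b), while the two
  Leibniz terms absorb one each. The surplus of one is paid by the weight, whence
  \<open>lam - \<kappa>\<close>.\<close>

lemma weighted_derivation_add_scale:
  fixes scale :: "'k::field \<Rightarrow> 'a::ab_group_add \<Rightarrow> 'a"
  assumes "vector_space scale" and "bilinear_op scale mult"
    and "algebra_map scale mult \<xi>" and "weighted_derivation scale mult lam \<xi> D"
  shows "weighted_derivation scale mult (lam - \<kappa>) \<xi> (\<lambda>a. D a + scale \<kappa> (\<xi> a))"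
proof -
  interpret vector_space scale by fact
  show ?thesis
    using assms(1)
    by (simp add: weighted_derivation_def Vector_Spaces.linear_iff bilinear_opD[OF assms(2)]
        algebra_mapD[OF assms(3)] weighted_derivationD[OF assms(4)]
        scale_right_distrib scale_left_diff_distrib mult.commute algebra_simps)
qed

context bihom_commutative_associative_algebra
begin

lemma bihom_novikov_of_weighted_derivation:
  fixes \<xi> E :: "'b \<Rightarrow> 'b" and \<nu> :: 'a
  assumes \<xi>: "algebra_map scale mult \<xi>"
    and E: "weighted_derivation scale mult \<nu> \<xi> E"
    and \<alpha>\<xi>: "\<And>a. \<alpha> (\<xi> a) = \<xi> (\<alpha> a)" and \<beta>\<xi>: "\<And>a. \<beta> (\<xi> a) = \<xi> (\<beta> a)"
    and \<alpha>E: "\<And>a. E (\<alpha> a) = \<alpha> (E a)" and \<beta>E: "\<And>a. E (\<beta> a) = \<beta> (E a)"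
    and \<xi>E: "\<And>a. E (\<xi> a) = \<xi> (E a)"
  shows "bihom_novikov_algebra scale (\<lambda>a b. mult (\<xi> a) (E b)) (\<alpha> \<circ> \<xi>) (\<beta> \<circ> \<xi>)"
proof -
  note vs = vector_space_axioms
  note bil = bilinear_opD[OF bilinear]
  note lin = algebra_mapD[OF \<xi>] algebra_mapD[OF algebra_map_\<alpha>] algebra_mapD[OF algebra_map_\<beta>]
  note der = weighted_derivationD[OF E]
  have \<alpha>\<beta>: "\<beta> (\<alpha> a) = \<alpha> (\<beta> a)" for a
    using \<alpha>_\<beta>_commute by (metis comp_apply)
  \<comment> \<open>Oriented as rewrite rules, these give every composite the normal form \<alpha>,
    \<beta>, \<xi>, \<open>E\<close> from the outside in.\<close>
  note comm = \<alpha>\<xi>[symmetric] \<beta>\<xi>[symmetric] \<alpha>E \<beta>E \<xi>E \<alpha>\<beta>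
  have map_star: "algebra_map scale (\<lambda>a b. mult (\<xi> a) (E b)) (f \<circ> \<xi>)"
    if f: "algebra_map scale mult f" and "\<And>a. f (\<xi> a) = \<xi> (f a)" "\<And>a. E (f a) = f (E a)" for f
    using algebra_map_comp[OF f \<xi>] algebra_mapD[OF f] that(2,3)
    by (simp add: algebra_map_def lin \<xi>E)
  \<comment> \<open>Re-bracketing to the left exposes \<beta>(u) \<alpha>(v), which
    BiHom-commutativity makes symmetric in u and v.\<close>
  have swap: "mult (\<alpha> (\<beta> u)) (mult (\<alpha> v) w) = mult (\<alpha> (\<beta> v)) (mult (\<alpha> u) w)" for u v w
    by (simp add: bihom_assoc bihom_comm[of u v])
  show ?thesis
  proof unfold_locales
    show "bilinear_op scale (\<lambda>a b. mult (\<xi> a) (E b))"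
      using vs by (simp add: bilinear_op_def Vector_Spaces.linear_iff bil lin der)
    show "algebra_map scale (\<lambda>a b. mult (\<xi> a) (E b)) (\<alpha> \<circ> \<xi>)"
      by (rule map_star[OF algebra_map_\<alpha> \<alpha>\<xi> \<alpha>E])
    show "algebra_map scale (\<lambda>a b. mult (\<xi> a) (E b)) (\<beta> \<circ> \<xi>)"
      by (rule map_star[OF algebra_map_\<beta> \<beta>\<xi> \<beta>E])
    show "(\<alpha> \<circ> \<xi>) \<circ> (\<beta> \<circ> \<xi>) = (\<beta> \<circ> \<xi>) \<circ> (\<alpha> \<circ> \<xi>)"
      by (simp add: fun_eq_iff comm)
    let ?L = "\<lambda>a b c. mult (\<xi> ((\<alpha> \<circ> \<xi>) ((\<beta> \<circ> \<xi>) a))) (E (mult (\<xi> ((\<alpha> \<circ> \<xi>) b)) (E c)))"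
    let ?R = "\<lambda>a b c. mult (\<xi> (mult (\<xi> ((\<beta> \<circ> \<xi>) a)) (E ((\<alpha> \<circ> \<xi>) b)))) (E ((\<beta> \<circ> \<xi>) c))"
    \<comment> \<open>The middle Leibniz term of \<open>?L\<close>, re-bracketed, is
      \<open>?R\<close> and cancels. The two survivors are stated bracketed to the right, the shape
      that \<open>swap\<close> matches.\<close>
    have diff: "?L a b c - ?R a b c =
        mult (\<alpha> (\<beta> (\<xi> (\<xi> (\<xi> a))))) (mult (\<alpha> (\<xi> (\<xi> (\<xi> b)))) (E (E c))) +
        scale \<nu> (mult (\<alpha> (\<beta> (\<xi> (\<xi> (\<xi> a))))) (mult (\<alpha> (\<xi> (\<xi> (\<xi> b)))) (\<xi> (E c))))" for a b c
      by (simp add: comm lin der bil bihom_assoc)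
    \<comment> \<open>\<open>swap\<close> is permutative, so ordered rewriting brings both sides to
      the same form.\<close>
    show "?L a b c - ?R a b c = ?L b a c - ?R b a c" for a b c
      unfolding diff by (simp only: swap)
    show "mult (\<xi> (mult (\<xi> a) (E ((\<beta> \<circ> \<xi>) b)))) (E ((\<alpha> \<circ> \<xi>) ((\<beta> \<circ> \<xi>) c))) =
        mult (\<xi> (mult (\<xi> a) (E ((\<beta> \<circ> \<xi>) c)))) (E ((\<alpha> \<circ> \<xi>) ((\<beta> \<circ> \<xi>) b)))" for a b c
    proof -
      \<comment> \<open>Both sides equal \<alpha>(x) times the symmetric product \<beta>(u)
        \<alpha>(v). The goal is the instance where x, u, v are the images of a under \<xi>\<xi> and
        of b, c under \<xi>\<xi>\<open>E\<close>.\<close>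
      have "mult (mult x (\<beta> u)) (\<alpha> (\<beta> v)) = mult (mult x (\<beta> v)) (\<alpha> (\<beta> u))" for x u v
        by (metis \<alpha>\<beta> bihom_assoc bihom_comm)
      then show ?thesis
        by (simp add: comm lin)
    qed
  qed
qed

end

theorem theorem3p7:
  fixes scale :: "'k::field \<Rightarrow> 'a::ab_group_add \<Rightarrow> 'a"
    and \<mu> :: "'a \<Rightarrow> 'a \<Rightarrow> 'a"
    and \<alpha> \<beta> \<xi> D :: "'a \<Rightarrow> 'a"
    and \<kappa> lam :: 'k
  assumes "bihom_commutative_associative_algebra scale \<mu> \<alpha> \<beta>"
    and "algebra_map scale \<mu> \<xi>"
    and "weighted_derivation scale \<mu> lam \<xi> D"
    and "\<forall>f \<in> {\<alpha>, \<beta>, \<xi>, D}. \<forall>g \<in> {\<alpha>, \<beta>, \<xi>, D}. f \<circ> g = g \<circ> f"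
  defines "star \<equiv> (\<lambda>a b. \<mu> (\<xi> a) (D b) + scale \<kappa> (\<mu> (\<xi> a) (\<xi> b)))"
  shows "bihom_pre_lie_algebra scale star (\<alpha> \<circ> \<xi>) (\<beta> \<circ> \<xi>) \<and>
         bihom_novikov_algebra scale star (\<alpha> \<circ> \<xi>) (\<beta> \<circ> \<xi>)"
proof -
  interpret bihom_commutative_associative_algebra scale \<mu> \<alpha> \<beta> by fact
  have comm: "f (g a) = g (f a)" if "f \<in> {\<alpha>, \<beta>, \<xi>, D}" "g \<in> {\<alpha>, \<beta>, \<xi>, D}" for f g a
    using assms(4) that by (metis comp_apply)
  note lin = algebra_mapD[OF assms(2)] algebra_mapD[OF algebra_map_\<alpha>]
    algebra_mapD[OF algebra_map_\<beta>]
  define E where "E = (\<lambda>a. D a + scale \<kappa> (\<xi> a))"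
  have star: "star = (\<lambda>a b. \<mu> (\<xi> a) (E b))"
    by (simp add: star_def E_def bilinear_opD[OF bilinear])
  have "bihom_novikov_algebra scale star (\<alpha> \<circ> \<xi>) (\<beta> \<circ> \<xi>)"
    unfolding star
  proof (rule bihom_novikov_of_weighted_derivation[OF assms(2)])
    show "weighted_derivation scale \<mu> (lam - \<kappa>) \<xi> E"
      unfolding E_def
      by (rule weighted_derivation_add_scale[OF vector_space_axioms bilinear assms(2,3)])
    \<comment> \<open>\<open>E\<close> is a linear combination of \<open>D\<close> and \<xi>, so any
      linear map commuting with both commutes with \<open>E\<close>.\<close>
    show "E (\<alpha> a) = \<alpha> (E a)" for a
      by (simp add: E_def lin comm[of \<alpha> D] comm[of \<alpha> \<xi>])
    show "E (\<beta> a) = \<beta> (E a)" for a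
      by (simp add: E_def lin comm[of \<beta> D] comm[of \<beta> \<xi>])
    show "E (\<xi> a) = \<xi> (E a)" for a
      by (simp add: E_def lin comm[of \<xi> D])
  qed (auto intro: comm)
  then show ?thesis
    by (simp add: bihom_novikov_algebra.axioms(1))
qed

end
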